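(* Let $A,B$ be disjoint finite sets, let $\mathcal V_{AB}$ be a linkage (a linear subspace of $\mathbb F^{A\uplus B}$) and let $\lambda,\lambda_1,\lambda_2\in\mathbb F$. Then 1. $(\lambda_1+\lambda_2)^b\,\mathcal V_{AB}=\lambda_1^b\mathcal V_{AB}\;+_b\;\lambda_2^b\mathcal V_{AB}$; 2. $(\lambda^b\mathcal V_{AB})^T=\lambda^a\,\mathcal V_{AB}^T$.
   Context: Fix a field $\mathbb F$; all index sets are finite. A vector on $X$ is a function $X\to\mathbb F$. For disjoint $A,B$ a vector on $A\uplus B$ is written $(f_A,f_B)$. For a subspace $\mathcal V_{AB}$ of vectors on $A\uplus B$: $\mathcal V_{AB}\times B:=\{g_B:(0_A,g_B)\in\mathcal V_{AB}\}$ and $\mathcal V_{AB}\times A:=\{f_A:(f_A,0_B)\in\mathcal V_{AB}\}$. $\mathcal V^\perp$ is the set of all $g$ with $\sum_e f(e)g(e)=0$ for all $f\in\mathcal V$. Scalar multiplication (for every $\lambda\in\mathbb F$, including $0$): $\lambda^b\mathcal V_{AB}:=\{(f_A,\lambda g_B):(f_A,g_B)\in\mathcal V_{AB}\}+\{(0_A,h_B):h_B\in\mathcal V_{AB}\times B\}$ and, symmetrically, $\lambda^a\mathcal V_{AB}:=\{(\lambda f_A,g_B):(f_A,g_B)\in\mathcal V_{AB}\}+\{(h_A,0_B):h_A\in\mathcal V_{AB}\times A\}$. Intersection-sum: $\mathcal V_{AB}+_b\hat{\mathcal V}_{AB}:=\{(f_A,f_B^1+f_B^2):(f_A,f^1_B)\in\mathcal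 V_{AB},\ (f_A,f_B^2)\in\hat{\mathcal V}_{AB}\}$. Transpose: $\mathcal V_{AB}^T:=\{(f_A,-f_B):(f_A,f_B)\in\mathcal V_{AB}^\perp\}$. *)

theory Defs
  imports Complex_Main "HOL-Library.Function_Algebras" "HOL-Library.Set_Algebras"
begin

text \<open>
  Vectors on an index set \<open>X\<close> are the functions on the ambient index type that vanish outside
  \<open>X\<close>, so that they correspond one-to-one to the functions from \<open>X\<close> to the field, and addition
  is the pointwise addition of functions.
\<close>

definition vecs :: "'e set \<Rightarrow> ('e \<Rightarrow> 'f::field) set" where
  "vecs X = {f. \<forall>e. e \<notin> X \<longrightarrow> f e = 0}"

definition vscale :: "'f::field \<Rightarrow> ('e \<Rightarrow> 'f) \<Rightarrow> 'e \<Rightarrow> 'f" where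
  "vscale c f = (\<lambda>e. c * f e)"

global_interpretation fun_vs: vector_space "vscale :: 'f::field \<Rightarrow> ('e \<Rightarrow> 'f) \<Rightarrow> 'e \<Rightarrow> 'f"
  by unfold_locales (auto simp: vscale_def fun_eq_iff algebra_simps)

text \<open>The vector \<open>(f\<^sub>A, g\<^sub>B)\<close> on the disjoint union of \<open>A\<close> and \<open>B\<close>.\<close>

definition vpair :: "'e set \<Rightarrow> 'e set \<Rightarrow> ('e \<Rightarrow> 'f::field) \<Rightarrow> ('e \<Rightarrow> 'f) \<Rightarrow> 'e \<Rightarrow> 'f" where
  "vpair A B f g = (\<lambda>e. if e \<in> A then f e else if e \<in> B then g e else 0)"

definition linkage :: "'e set \<Rightarrow> 'e set \<Rightarrow> ('e \<Rightarrow> 'f::field) set \<Rightarrow> bool" where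
  "linkage A B V \<longleftrightarrow> V \<subseteq> vecs (A \<union> B) \<and> fun_vs.subspace V"

text \<open>\<open>V \<times> A\<close> and \<open>V \<times> B\<close>; despite the notation these are not Cartesian products.\<close>

definition cross_A :: "'e set \<Rightarrow> 'e set \<Rightarrow> ('e \<Rightarrow> 'f::field) set \<Rightarrow> ('e \<Rightarrow> 'f) set" where
  "cross_A A B V = {f \<in> vecs A. vpair A B f 0 \<in> V}"

definition cross_B :: "'e set \<Rightarrow> 'e set \<Rightarrow> ('e \<Rightarrow> 'f::field) set \<Rightarrow> ('e \<Rightarrow> 'f) set" where
  "cross_B A B V = {g \<in> vecs B. vpair A B 0 g \<in> V}"

definition perp :: "'e set \<Rightarrow> ('e \<Rightarrow> 'f::field) set \<Rightarrow> ('e \<Rightarrow> 'f) set" where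
  "perp X V = {g \<in> vecs X. \<forall>f\<in>V. (\<Sum>e\<in>X. f e * g e) = 0}"

text \<open>In the next two definitions the outer \<open>+\<close> is the elementwise sum of sets of vectors.\<close>

definition scale_b ::
    "'e set \<Rightarrow> 'e set \<Rightarrow> 'f::field \<Rightarrow> ('e \<Rightarrow> 'f) set \<Rightarrow> ('e \<Rightarrow> 'f) set" where
  "scale_b A B c V =
     {vpair A B f (vscale c g) | f g. f \<in> vecs A \<and> g \<in> vecs B \<and> vpair A B f g \<in> V}
     + {vpair A B 0 h | h. h \<in> cross_B A B V}"

definition scale_a ::
    "'e set \<Rightarrow> 'e set \<Rightarrow> 'f::field \<Rightarrow> ('e \<Rightarrow> 'f) set \<Rightarrow> ('e \<Rightarrow> 'f) set" where
  "scale_a A B c V =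
     {vpair A B (vscale c f) g | f g. f \<in> vecs A \<and> g \<in> vecs B \<and> vpair A B f g \<in> V}
     + {vpair A B h 0 | h. h \<in> cross_A A B V}"

definition isum_b ::
    "'e set \<Rightarrow> 'e set \<Rightarrow> ('e \<Rightarrow> 'f::field) set \<Rightarrow> ('e \<Rightarrow> 'f) set \<Rightarrow> ('e \<Rightarrow> 'f) set" where
  "isum_b A B V W =
     {vpair A B f (g1 + g2) | f g1 g2.
        f \<in> vecs A \<and> g1 \<in> vecs B \<and> g2 \<in> vecs B \<and> vpair A B f g1 \<in> V \<and> vpair A B f g2 \<in> W}"

definition link_transpose ::
    "'e set \<Rightarrow> 'e set \<Rightarrow> ('e \<Rightarrow> 'f::field) set \<Rightarrow> ('e \<Rightarrow> 'f) set" where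
  "link_transpose A B V =
     {vpair A B f (- g) | f g. f \<in> vecs A \<and> g \<in> vecs B \<and> vpair A B f g \<in> perp (A \<union> B) V}"

end

theory Submission
  imports Defs
begin

text \<open>
  Both identities become transparent once membership in a scaled linkage is written out:
  \<open>\<lambda>\<^sup>b V\<close> consists of the vectors \<open>(f, \<lambda> g + h)\<close> with \<open>(f, g) \<in> V\<close> and \<open>(0, h) \<in> V\<close>.

  For the distributive law, a vector on the right has the form
  \<open>(f, \<lambda>\<^sub>1 g + h\<^sub>1 + \<lambda>\<^sub>2 g' + h\<^sub>2)\<close>, where \<open>g\<close> and \<open>g'\<close> may differ. As both are paired with the
  same \<open>f\<close>, the difference \<open>g' - g\<close> lies in \<open>V \<times> B\<close>, so replacing \<open>g'\<close> by \<open>g\<close> costs only a term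
  that the summand \<open>V \<times> B\<close> absorbs.

  For the transpose, testing against the generators \<open>(f, \<lambda> g)\<close> and \<open>(0, h)\<close> of \<open>\<lambda>\<^sup>b V\<close> and moving
  the scalar across the dot product shows that \<open>(p, q)\<close> is orthogonal to \<open>\<lambda>\<^sup>b V\<close> iff
  \<open>(p, \<lambda> q)\<close> is orthogonal to \<open>V\<close> and \<open>q\<close> is orthogonal to \<open>V \<times> B\<close>
  (lemma \<open>perp_scale_b_iff\<close>). The substance is the duality between contraction and restriction,
  \<open>(V \<times> B)\<^sup>\<bottom> = {q. \<exists>r. (r, q) \<in> V\<^sup>\<bottom>}\<close>, whose nontrivial inclusion from left to
  right is lemma \<open>perp_cross_B_extend\<close>: given such an \<open>r\<close>, the vector
  \<open>(p - \<lambda> r, 0) = (p, \<lambda> q) - \<lambda> (r, q)\<close> is orthogonal to \<open>V\<close>, and \<open>p = \<lambda> r + (p - \<lambda> r)\<close> is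
  precisely the decomposition that membership in \<open>\<lambda>\<^sup>a V\<^sup>T\<close> asks for. Nothing is ever divided by
  \<open>\<lambda>\<close>, so \<open>\<lambda> = 0\<close> is not a special case.
\<close>

section \<open>Vectors on a disjoint union\<close>

lemma vecs_closed:
  assumes "f \<in> vecs X" "g \<in> vecs X"
  shows "f + g \<in> vecs X" "f - g \<in> vecs X" "- f \<in> vecs X" "vscale c f \<in> vecs X"
  using assms by (auto simp: vecs_def vscale_def)

lemma zero_in_vecs: "0 \<in> vecs X"
  by (simp add: vecs_def)

lemma vpair_add: "vpair A B f g + vpair A B f' g' = vpair A B (f + f') (g + g')"
  by (auto simp: vpair_def fun_eq_iff)

lemma vpair_diff: "vpair A B f g - vpair A B f' g' = vpair A B (f - f') (g - g')"
  by (auto simp: vpair_def fun_eq_iff)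

lemma vpair_vscale: "vscale c (vpair A B f g) = vpair A B (vscale c f) (vscale c g)"
  by (auto simp: vpair_def vscale_def fun_eq_iff)

lemma vpair_zero_in_linkage:
  assumes "linkage A B V"
  shows "vpair A B 0 0 \<in> V"
proof -
  have "0 \<in> V" using assms fun_vs.subspace_0 by (auto simp: linkage_def)
  moreover have "(0 :: 'a \<Rightarrow> 'b) = vpair A B 0 0" by (simp add: vpair_def fun_eq_iff)
  ultimately show ?thesis by (simp only:)
qed

lemma vpair_in_vecs: "vpair A B f g \<in> vecs (A \<union> B)"
  by (auto simp: vpair_def vecs_def)

lemma vpair_inject:
  assumes "A \<inter> B = {}" "f \<in> vecs A" "f' \<in> vecs A" "g \<in> vecs B" "g' \<in> vecs B"
  shows "vpair A B f g = vpair A B f' g' \<longleftrightarrow> f = f' \<and> g = g'"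
proof
  assume eq: "vpair A B f g = vpair A B f' g'"
  have "f e = f' e \<and> g e = g' e" for e
    using fun_cong[OF eq, of e] assms
    by (cases "e \<in> A"; cases "e \<in> B") (auto simp: vpair_def vecs_def)
  then show "f = f' \<and> g = g'" by auto
qed simp

lemma vecs_Un_vpair_cases:
  assumes "v \<in> vecs (A \<union> B)"
  obtains f g where "f \<in> vecs A" "g \<in> vecs B" "v = vpair A B f g"
proof
  show "vpair A {} v 0 \<in> vecs A" "vpair B {} v 0 \<in> vecs B"
    "v = vpair A B (vpair A {} v 0) (vpair B {} v 0)"
    using assms by (auto simp: vecs_def vpair_def fun_eq_iff)
qed

lemma sum_vpair_mult:
  assumes "finite A" "finite B" "A \<inter> B = {}"
  shows "(\<Sum>e\<in>A \<union> B. vpair A B f g e * vpair A B p q e)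
       = (\<Sum>e\<in>A. f e * p e) + (\<Sum>e\<in>B. g e * q e)"
proof -
  have "(\<Sum>e\<in>B. vpair A B f g e * vpair A B p q e) = (\<Sum>e\<in>B. g e * q e)"
    using assms(3) by (intro sum.cong) (auto simp: vpair_def)
  then show ?thesis
    using assms by (simp add: sum.union_disjoint) (simp add: vpair_def)
qed

section \<open>Membership in the constructed linkages\<close>

lemma scale_b_iff:
  "v \<in> scale_b A B c V \<longleftrightarrow> (\<exists>f\<in>vecs A. \<exists>g\<in>vecs B. \<exists>h\<in>vecs B.
     vpair A B f g \<in> V \<and> vpair A B 0 h \<in> V \<and> v = vpair A B f (vscale c g + h))"
  unfolding scale_b_def cross_B_def set_plus_def
  by (fastforce simp: vpair_add)

lemma scale_a_iff:
  "v \<in> scale_a A B c V \<longleftrightarrow> (\<exists>f\<in>vecs A. \<exists>g\<in>vecs B. \<exists>h\<in>vecs A.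
     vpair A B f g \<in> V \<and> vpair A B h 0 \<in> V \<and> v = vpair A B (vscale c f + h) g)"
  unfolding scale_a_def cross_A_def set_plus_def
  by (fastforce simp: vpair_add)

lemma perp_iff:
  assumes "finite A" "finite B" "A \<inter> B = {}" "V \<subseteq> vecs (A \<union> B)"
  shows "vpair A B p q \<in> perp (A \<union> B) V \<longleftrightarrow> (\<forall>f\<in>vecs A. \<forall>g\<in>vecs B. vpair A B f g \<in> V \<longrightarrow>
     (\<Sum>e\<in>A. f e * p e) + (\<Sum>e\<in>B. g e * q e) = 0)" (is "?L \<longleftrightarrow> ?R")
proof
  assume ?L
  then show ?R
    by (auto simp: perp_def sum_vpair_mult[OF assms(1-3), symmetric])
next
  assume R: ?R
  have "(\<Sum>e\<in>A \<union> B. v e * vpair A B p q e) = 0" if "v \<in> V" for v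
  proof -
    from that assms(4) have "v \<in> vecs (A \<union> B)" by auto
    then obtain f g where "f \<in> vecs A" "g \<in> vecs B" "v = vpair A B f g"
      by (rule vecs_Un_vpair_cases)
    with R that show ?thesis by (simp add: sum_vpair_mult[OF assms(1-3)])
  qed
  then show ?L by (simp add: perp_def vpair_in_vecs)
qed

lemma subspace_perp: "fun_vs.subspace (perp X V)"
  by (auto simp: fun_vs.subspace_def perp_def vecs_def vscale_def algebra_simps
      sum.distrib simp flip: sum_distrib_left)

lemma link_transpose_iff:
  assumes "A \<inter> B = {}" "f \<in> vecs A" "g \<in> vecs B"
  shows "vpair A B f g \<in> link_transpose A B V \<longleftrightarrow> vpair A B f (- g) \<in> perp (A \<union> B) V"
proof
  assume "vpair A B f g \<in> link_transpose A B V"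
  then obtain f' g' where *: "f' \<in> vecs A" "g' \<in> vecs B"
      "vpair A B f' g' \<in> perp (A \<union> B) V" "vpair A B f g = vpair A B f' (- g')"
    by (auto simp: link_transpose_def)
  with assms have "f = f' \<and> g = - g'"
    by (subst (asm) vpair_inject) (auto intro: vecs_closed)
  with * show "vpair A B f (- g) \<in> perp (A \<union> B) V" by simp
next
  assume "vpair A B f (- g) \<in> perp (A \<union> B) V"
  with assms show "vpair A B f g \<in> link_transpose A B V"
    by (force simp: link_transpose_def intro: vecs_closed exI[of _ "- g"])
qed

section \<open>Distributivity over the intersection-sum\<close>

text \<open>
  Left to right, all of \<open>h\<close> goes into the second summand, which requires \<open>0 \<in> V \<times> B\<close> for the first.
\<close>

lemma scale_b_add:
  assumes "A \<inter> B = {}" "linkage A B V"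
  shows "scale_b A B (c1 + c2) V = isum_b A B (scale_b A B c1 V) (scale_b A B c2 V)"
proof (intro set_eqI iffI)
  fix v assume "v \<in> scale_b A B (c1 + c2) V"
  then obtain f g h where v: "f \<in> vecs A" "g \<in> vecs B" "h \<in> vecs B" "vpair A B f g \<in> V"
      "vpair A B 0 h \<in> V" "v = vpair A B f (vscale (c1 + c2) g + h)"
    by (auto simp: scale_b_iff)
  have "vpair A B 0 0 \<in> V"
    by (rule vpair_zero_in_linkage[OF assms(2)])
  with v have "vpair A B f (vscale c1 g + 0) \<in> scale_b A B c1 V"
      "vpair A B f (vscale c2 g + h) \<in> scale_b A B c2 V"
    using zero_in_vecs unfolding scale_b_iff by blast+
  moreover have "v = vpair A B f ((vscale c1 g + 0) + (vscale c2 g + h))"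
    using v(6) by (simp add: fun_vs.scale_left_distrib add.assoc)
  ultimately show "v \<in> isum_b A B (scale_b A B c1 V) (scale_b A B c2 V)"
    using v(1-3) zero_in_vecs unfolding isum_b_def by (blast intro: vecs_closed)
next
  fix v assume "v \<in> isum_b A B (scale_b A B c1 V) (scale_b A B c2 V)"
  then obtain f k1 k2 where k: "f \<in> vecs A" "k1 \<in> vecs B" "k2 \<in> vecs B"
      "vpair A B f k1 \<in> scale_b A B c1 V" "vpair A B f k2 \<in> scale_b A B c2 V"
      "v = vpair A B f (k1 + k2)"
    by (auto simp: isum_b_def)
  obtain f1 g1 h1 where 1: "f1 \<in> vecs A" "g1 \<in> vecs B" "h1 \<in> vecs B" "vpair A B f1 g1 \<in> V"
      "vpair A B 0 h1 \<in> V" "vpair A B f k1 = vpair A B f1 (vscale c1 g1 + h1)"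
    using k(4) by (auto simp: scale_b_iff)
  obtain f2 g2 h2 where 2: "f2 \<in> vecs A" "g2 \<in> vecs B" "h2 \<in> vecs B" "vpair A B f2 g2 \<in> V"
      "vpair A B 0 h2 \<in> V" "vpair A B f k2 = vpair A B f2 (vscale c2 g2 + h2)"
    using k(5) by (auto simp: scale_b_iff)
  have e1: "f1 = f" "k1 = vscale c1 g1 + h1" and e2: "f2 = f" "k2 = vscale c2 g2 + h2"
    using 1(6) 2(6) vpair_inject[OF assms(1)] k(1-3) 1(1-3) 2(1-3) vecs_closed by metis+
  \<comment> \<open>The correction by a multiple of \<open>(0, g2 - g1)\<close> accounts for the two choices of a
      \<open>B\<close>-part over the same \<open>f\<close>.\<close>
  define h where "h = h1 + h2 + vscale c2 (g2 - g1)"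
  have sub: "fun_vs.subspace V" using assms(2) by (simp add: linkage_def)
  have "vpair A B 0 (g2 - g1) \<in> V"
    using fun_vs.subspace_diff[OF sub 2(4) 1(4)] e1 e2 by (simp add: vpair_diff)
  then have "vpair A B 0 h1 + vpair A B 0 h2 + vscale c2 (vpair A B 0 (g2 - g1)) \<in> V"
    using 1(5) 2(5) sub by (intro fun_vs.subspace_add fun_vs.subspace_scale)
  then have "vpair A B 0 h \<in> V" by (simp add: vpair_add vpair_vscale h_def)
  moreover have "h \<in> vecs B" unfolding h_def using 1 2 by (intro vecs_closed)
  moreover have "v = vpair A B f (vscale (c1 + c2) g1 + h)"
    unfolding k(6) e1 e2 h_def
    by (simp add: fun_vs.scale_left_distrib fun_vs.scale_right_diff_distrib algebra_simps)
  ultimately show "v \<in> scale_b A B (c1 + c2) V"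
    using 1 e1 unfolding scale_b_iff by blast
qed

section \<open>Scaling and orthogonality\<close>

text \<open>
  Since \<open>V\<close> contains \<open>0\<close>, the two kinds of generators \<open>(f, c g)\<close> and \<open>(0, h)\<close> of \<open>c\<^sup>b V\<close> can be
  tested separately, and \<open>c\<close> moves from \<open>g\<close> to \<open>q\<close> in the dot product.
\<close>

lemma perp_scale_b_iff:
  assumes "finite A" "finite B" "A \<inter> B = {}" "linkage A B V"
  shows "vpair A B p q \<in> perp (A \<union> B) (scale_b A B c V) \<longleftrightarrow>
     vpair A B p (vscale c q) \<in> perp (A \<union> B) V \<and> (\<forall>h\<in>cross_B A B V. (\<Sum>e\<in>B. h e * q e) = 0)"
    (is "?L \<longleftrightarrow> ?R")
proof -
  have sub: "scale_b A B c V \<subseteq> vecs (A \<union> B)" and V: "V \<subseteq> vecs (A \<union> B)"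
    using assms(4) by (auto simp: scale_b_iff vpair_in_vecs linkage_def)
  have zero: "vpair A B 0 0 \<in> V"
    by (rule vpair_zero_in_linkage[OF assms(4)])
  have dot: "(\<Sum>e\<in>B. (vscale c g + h) e * q e)
      = (\<Sum>e\<in>B. g e * vscale c q e) + (\<Sum>e\<in>B. h e * q e)" for g h
    by (simp add: vscale_def algebra_simps sum.distrib)
  show ?thesis
  proof
    assume L: ?L
    have gen: "(\<Sum>e\<in>A. f e * p e) + (\<Sum>e\<in>B. (vscale c g + h) e * q e) = 0"
      if "f \<in> vecs A" "g \<in> vecs B" "h \<in> vecs B" "vpair A B f g \<in> V" "vpair A B 0 h \<in> V" for f g h
    proof -
      have "vpair A B f (vscale c g + h) \<in> scale_b A B c V"
        using that unfolding scale_b_iff by blast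
      moreover have "vscale c g + h \<in> vecs B" using that by (intro vecs_closed)
      ultimately show ?thesis
        using L that(1) unfolding perp_iff[OF assms(1-3) sub] by blast
    qed
    have "vpair A B p (vscale c q) \<in> perp (A \<union> B) V"
      unfolding perp_iff[OF assms(1-3) V]
    proof (intro ballI impI)
      fix f g assume "f \<in> vecs A" "g \<in> vecs B" "vpair A B f g \<in> V"
      from gen[OF this(1,2) zero_in_vecs this(3) zero]
      show "(\<Sum>e\<in>A. f e * p e) + (\<Sum>e\<in>B. g e * vscale c q e) = 0"
        unfolding dot by simp
    qed
    moreover have "(\<Sum>e\<in>B. h e * q e) = 0" if "h \<in> cross_B A B V" for h
      using gen[OF zero_in_vecs zero_in_vecs _ zero, of h] that
      unfolding dot by (simp add: cross_B_def)
    ultimately show ?R by blast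
  next
    assume R: ?R
    show ?L unfolding perp_iff[OF assms(1-3) sub]
    proof (intro ballI impI)
      fix f k assume fk: "f \<in> vecs A" "k \<in> vecs B" "vpair A B f k \<in> scale_b A B c V"
      then obtain f' g h where g: "f' \<in> vecs A" "g \<in> vecs B" "h \<in> vecs B" "vpair A B f' g \<in> V"
          "vpair A B 0 h \<in> V" "vpair A B f k = vpair A B f' (vscale c g + h)"
        by (auto simp: scale_b_iff)
      have eq: "f = f'" "k = vscale c g + h"
        using g(6) vpair_inject[OF assms(3)] fk(1,2) g(1-3) vecs_closed by metis+
      have "(\<Sum>e\<in>A. f' e * p e) + (\<Sum>e\<in>B. g e * vscale c q e) = 0"
        using R g(1,2,4) unfolding perp_iff[OF assms(1-3) V] by blast
      moreover have "(\<Sum>e\<in>B. h e * q e) = 0"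
        using R g(3,5) by (simp add: cross_B_def)
      ultimately show "(\<Sum>e\<in>A. f e * p e) + (\<Sum>e\<in>B. k e * q e) = 0"
        unfolding eq dot by simp
    qed
  qed
qed

text \<open>
  A functional is determined by its values on the unit vectors; the induction peels off one
  coordinate at a time. This turns an abstract functional into a vector on \<open>A\<close> that can serve as
  a member of an orthogonal complement.
\<close>

lemma linear_functional_eq_dot:
  fixes \<phi> :: "('e \<Rightarrow> 'f::field) \<Rightarrow> 'f"
  assumes "finite A" and add: "\<And>u v. \<phi> (u + v) = \<phi> u + \<phi> v"
    and scale: "\<And>c u. \<phi> (vscale c u) = c * \<phi> u" and "f \<in> vecs A"
  shows "\<phi> f = (\<Sum>a\<in>A. f a * \<phi> (\<lambda>e. if e = a then 1 else 0))"
  using \<open>finite A\<close> \<open>f \<in> vecs A\<close>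
proof (induction A arbitrary: f rule: finite_induct)
  case empty
  then have "vscale 0 f = f" by (simp add: vecs_def vscale_def fun_eq_iff)
  with scale[of 0 f] have "\<phi> f = 0" by (simp only: mult_zero_left)
  then show ?case by simp
next
  case (insert a A)
  let ?u = "\<lambda>e. if e = a then 1 else 0 :: 'f"
  have split: "f = f(a := 0) + vscale (f a) ?u" by (auto simp: vscale_def fun_eq_iff)
  have "f(a := 0) \<in> vecs A" using insert.prems by (auto simp: vecs_def)
  note insert.IH[OF this]
  also have "(\<Sum>b\<in>A. (f(a := 0)) b * \<phi> (\<lambda>e. if e = b then 1 else 0))
      = (\<Sum>b\<in>A. f b * \<phi> (\<lambda>e. if e = b then 1 else 0))"
    using insert.hyps(2) by (intro sum.cong) auto
  finally have "\<phi> (f(a := 0)) = (\<Sum>b\<in>A. f b * \<phi> (\<lambda>e. if e = b then 1 else 0))" .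
  moreover have "\<phi> f = \<phi> (f(a := 0)) + f a * \<phi> ?u"
    by (subst split) (simp only: add scale)
  ultimately show ?case using insert.hyps by (simp add: add.commute)
qed

global_interpretation fun_vs_pair: vector_space_pair
  "vscale :: 'f::field \<Rightarrow> ('e \<Rightarrow> 'f) \<Rightarrow> 'e \<Rightarrow> 'f" "vscale :: 'f::field \<Rightarrow> ('e \<Rightarrow> 'f) \<Rightarrow> 'e \<Rightarrow> 'f"
  by unfold_locales

text \<open>
  Since \<open>q\<close> kills \<open>V \<times> B\<close>, the value \<open>q \<bullet> g\<close> depends only on \<open>f\<close> when \<open>(f, g) \<in> V\<close>. This gives a
  functional on the projection of \<open>V\<close> to \<open>A\<close>, and it has to be extended to all vectors on \<open>A\<close>
  before it can be written as a dot product with some \<open>- r\<close>. A linear section of the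
  projection that is defined on the whole space provides the extension at once.
\<close>

lemma perp_cross_B_extend:
  fixes A B :: "'e set" and V :: "('e \<Rightarrow> 'f::field) set"
  assumes fin: "finite A" "finite B" and disj: "A \<inter> B = {}" and link: "linkage A B V"
    and q: "\<forall>h\<in>cross_B A B V. (\<Sum>e\<in>B. h e * q e) = 0"
  obtains r where "r \<in> vecs A" "vpair A B r q \<in> perp (A \<union> B) V"
proof -
  have sub: "fun_vs.subspace V" and V: "V \<subseteq> vecs (A \<union> B)"
    using link by (simp_all add: linkage_def)
  define \<pi> :: "('e \<Rightarrow> 'f) \<Rightarrow> 'e \<Rightarrow> 'f" where "\<pi> = (\<lambda>v e. if e \<in> A then v e else 0)"
  have lin: "Vector_Spaces.linear vscale vscale \<pi>"
    by unfold_locales (auto simp: \<pi>_def vscale_def fun_eq_iff algebra_simps)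
  have pi_vpair: "\<pi> (vpair A B f g) = f" if "f \<in> vecs A" for f g
    using that by (auto simp: \<pi>_def vpair_def vecs_def fun_eq_iff)
  obtain s where s: "range s \<subseteq> V" "Vector_Spaces.linear vscale vscale s"
      "\<And>f. f \<in> \<pi> ` V \<Longrightarrow> \<pi> (s f) = f"
    using fun_vs_pair.linear_exists_right_inverse_on[OF lin sub] by blast
  interpret s: Vector_Spaces.linear vscale vscale s by (rule s(2))
  define \<phi> where "\<phi> = (\<lambda>f. - (\<Sum>e\<in>B. s f e * q e))"
  have phi_add: "\<phi> (u + v) = \<phi> u + \<phi> v" for u v
    by (simp add: \<phi>_def s.add algebra_simps sum.distrib)
  have phi_scale: "\<phi> (vscale c u) = c * \<phi> u" for c u
    by (simp add: \<phi>_def s.scale vscale_def[of c "s u"] mult.assoc sum_distrib_left)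
  define r where "r = (\<lambda>a. if a \<in> A then \<phi> (\<lambda>e. if e = a then 1 else 0) else 0)"
  have phi_r: "\<phi> f = (\<Sum>a\<in>A. f a * r a)" if "f \<in> vecs A" for f
    by (subst linear_functional_eq_dot[of A \<phi>, OF fin(1) phi_add phi_scale that]) (simp add: r_def)
  have "vpair A B r q \<in> perp (A \<union> B) V"
    unfolding perp_iff[OF fin disj V]
  proof (intro ballI impI)
    fix f g assume fg: "f \<in> vecs A" "g \<in> vecs B" "vpair A B f g \<in> V"
    have "s f \<in> V" using s(1) by blast
    with V obtain f' g' where s_eq: "f' \<in> vecs A" "g' \<in> vecs B" "s f = vpair A B f' g'"
      by (meson subsetD vecs_Un_vpair_cases)
    have "f \<in> \<pi> ` V" using fg pi_vpair by (metis image_eqI)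
    from s(3)[OF this] have "f' = f" using s_eq pi_vpair by simp
    have "vpair A B f g - s f \<in> V" using fun_vs.subspace_diff[OF sub fg(3) \<open>s f \<in> V\<close>] .
    then have "g - g' \<in> cross_B A B V"
      using fg s_eq \<open>f' = f\<close> by (simp add: vpair_diff cross_B_def vecs_closed)
    with q have "(\<Sum>e\<in>B. g e * q e) = (\<Sum>e\<in>B. g' e * q e)"
      by (auto simp: left_diff_distrib sum_subtractf dest!: bspec)
    also have "\<dots> = (\<Sum>e\<in>B. s f e * q e)"
      using disj unfolding s_eq(3) by (intro sum.cong) (auto simp: vpair_def)
    also have "\<dots> = - \<phi> f" by (simp add: \<phi>_def)
    finally show "(\<Sum>e\<in>A. f e * r e) + (\<Sum>e\<in>B. g e * q e) = 0"
      using phi_r[OF fg(1)] by simp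
  qed
  moreover have "r \<in> vecs A" by (simp add: r_def vecs_def)
  ultimately show thesis using that by blast
qed

lemma link_transpose_scale_b:
  assumes fin: "finite A" "finite B" and disj: "A \<inter> B = {}" and link: "linkage A B V"
  shows "link_transpose A B (scale_b A B c V) = scale_a A B c (link_transpose A B V)"
proof (intro set_eqI iffI)
  have V: "V \<subseteq> vecs (A \<union> B)" using link by (simp add: linkage_def)
  note perp_add = fun_vs.subspace_add[OF subspace_perp]
    and perp_scale = fun_vs.subspace_scale[OF subspace_perp]
    and perp_diff = fun_vs.subspace_diff[OF subspace_perp]
  {
    fix v assume "v \<in> link_transpose A B (scale_b A B c V)"
    then obtain p q where pq: "p \<in> vecs A" "q \<in> vecs B" "v = vpair A B p (- q)"
        "vpair A B p q \<in> perp (A \<union> B) (scale_b A B c V)"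
      by (auto simp: link_transpose_def)
    then have pcq: "vpair A B p (vscale c q) \<in> perp (A \<union> B) V"
      and qh: "\<forall>h\<in>cross_B A B V. (\<Sum>e\<in>B. h e * q e) = 0"
      using perp_scale_b_iff[OF assms] by blast+
    obtain r where r: "r \<in> vecs A" "vpair A B r q \<in> perp (A \<union> B) V"
      using perp_cross_B_extend[OF assms qh] .
    define h where "h = p - vscale c r"
    have h: "h \<in> vecs A" unfolding h_def using pq r by (intro vecs_closed)
    have "vpair A B h 0 \<in> perp (A \<union> B) V"
      using perp_diff[OF pcq perp_scale[OF r(2), of c]] by (simp add: vpair_vscale vpair_diff h_def)
    then have "vpair A B h 0 \<in> link_transpose A B V"
      using link_transpose_iff[OF disj h zero_in_vecs] by simp
    moreover have "vpair A B r (- q) \<in> link_transpose A B V"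
      using r link_transpose_iff[OF disj r(1) vecs_closed(3)[OF pq(2) pq(2)]] by simp
    moreover have "v = vpair A B (vscale c r + h) (- q)" using pq by (simp add: h_def)
    ultimately show "v \<in> scale_a A B c (link_transpose A B V)"
      unfolding scale_a_iff using r(1) h vecs_closed(3)[OF pq(2) pq(2)] by blast
  }
  {
    fix v assume "v \<in> scale_a A B c (link_transpose A B V)"
    then obtain f g h where fgh: "f \<in> vecs A" "g \<in> vecs B" "h \<in> vecs A"
        "vpair A B f g \<in> link_transpose A B V" "vpair A B h 0 \<in> link_transpose A B V"
        and v: "v = vpair A B (vscale c f + h) g"
      by (auto simp: scale_a_iff)
    have fg: "vpair A B f (- g) \<in> perp (A \<union> B) V" and h0: "vpair A B h 0 \<in> perp (A \<union> B) V"
      using fgh link_transpose_iff[OF disj, of _ _ V] zero_in_vecs[of B] by fastforce+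
    have "vpair A B (vscale c f + h) (vscale c (- g)) \<in> perp (A \<union> B) V"
      using perp_add[OF perp_scale[OF fg] h0, of c] by (simp add: vpair_vscale vpair_add)
    moreover have "(\<Sum>e\<in>B. k e * (- g) e) = 0" if "k \<in> cross_B A B V" for k
    proof -
      from that have "k \<in> vecs B" "vpair A B 0 k \<in> V" by (auto simp: cross_B_def)
      with fg zero_in_vecs[of A]
      have "(\<Sum>e\<in>A. 0 e * f e) + (\<Sum>e\<in>B. k e * (- g) e) = 0"
        unfolding perp_iff[OF fin disj V] by blast
      then show ?thesis by simp
    qed
    ultimately have "vpair A B (vscale c f + h) (- g) \<in> perp (A \<union> B) (scale_b A B c V)"
      unfolding perp_scale_b_iff[OF assms] by blast
    moreover have "vscale c f + h \<in> vecs A" using fgh by (intro vecs_closed)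
    ultimately show "v \<in> link_transpose A B (scale_b A B c V)"
      using v link_transpose_iff[OF disj _ fgh(2)] by blast
  }
qed

theorem theorem21:
  fixes A B :: "'e set" and V :: "('e \<Rightarrow> 'f::field) set" and c c1 c2 :: 'f
  assumes "finite A" and "finite B" and "A \<inter> B = {}" and "linkage A B V"
  shows "scale_b A B (c1 + c2) V = isum_b A B (scale_b A B c1 V) (scale_b A B c2 V)
       \<and> link_transpose A B (scale_b A B c V) = scale_a A B c (link_transpose A B V)"
  using scale_b_add[OF assms(3,4)] link_transpose_scale_b[OF assms] by blast

end
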